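(* Let $b>0$, let $q\in C[-b,b]$ be complex valued, let $h\in\mathbb{C}$, and let $\mathbf{K}$ be the transmutation kernel associated with $q$ and $h$ (defined in the context). Put $Q(x):=\int_0^x q(s)\,ds$. Then for all $x\in[-b,b]$ $$\mathbf{K}_1(x,-x)=\mathbf{K}_2(x,-x)=\frac{q(0)}{4}+\frac h4 Q(x).$$
   Context: The kernel is $\mathbf{K}(x,t)=\mathbf{H}\big(\frac{x+t}{2},\frac{x-t}{2}\big)$ for $(x,t)\in\overline{\mathbf{S}}=[-b,b]\times[-b,b]$, where $\mathbf{H}$ is the unique solution of the Goursat problem $\frac{\partial^2\mathbf{H}(u,v)}{\partial u\,\partial v}=q(u+v)\mathbf{H}(u,v)$, $\mathbf{H}(u,0)=\frac h2+\frac12\int_0^u q(s)\,ds$, $\mathbf{H}(0,v)=\frac h2$; equivalently, $\mathbf{H}(u,v)=\frac h2+\frac12\int_0^u q(s)\,ds+\int_0^u\int_0^v q(\alpha+\beta)\mathbf{H}(\alpha,\beta)\,d\beta\,d\alpha$. The kernel is continuously differentiable on $\overline{\mathbf{S}}$. $\mathbf{K}_1(x,t)$ and $\mathbf{K}_2(x,t)$ denote the partial derivatives of $\mathbf{K}$ with respect to its first and second variable respectively; $\mathbf{K}_i(x,-x)$ is the value of this partial derivative at the point $(x,-x)$. (One-sided derivatives at the boundary of the square.) *)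

theory Defs
  imports "HOL-Analysis.Analysis"
begin

text \<open>
  In the characteristic variables \<open>u = (x + t) / 2\<close>, \<open>v = (x - t) / 2\<close> the square
  \<open>[-b, b] \<times> [-b, b]\<close> becomes the following diamond.
\<close>

definition goursat_domain :: "real \<Rightarrow> (real \<times> real) set" where
  "goursat_domain b = {(u, v). u + v \<in> {-b..b} \<and> u - v \<in> {-b..b}}"

text \<open>
  The mixed derivative \<open>\<partial>/\<partial>u (\<partial>H/\<partial>v)\<close> is required only in the interior: at the corners of
  the diamond its horizontal and vertical slices shrink to points. \<open>Hv\<close> is \<open>\<partial>H/\<partial>v\<close>, and its
  values outside the interior are irrelevant. Continuity up to the boundary ties the solution
  there to the equation inside. The interval integral is signed, so \<open>u < 0\<close> is covered.
\<close>

definition goursat_solution ::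
  "real \<Rightarrow> (real \<Rightarrow> complex) \<Rightarrow> complex \<Rightarrow> (real \<Rightarrow> real \<Rightarrow> complex) \<Rightarrow> bool" where
  "goursat_solution b q h H \<longleftrightarrow>
     continuous_on (goursat_domain b) (\<lambda>(u, v). H u v) \<and>
     (\<exists>Hv. \<forall>(u, v) \<in> interior (goursat_domain b).
        ((\<lambda>v'. H u v') has_vector_derivative Hv u v) (at v) \<and>
        ((\<lambda>u'. Hv u' v) has_vector_derivative q (u + v) * H u v) (at u)) \<and>
     (\<forall>u \<in> {-b..b}. H u 0 = h / 2 + 1 / 2 * (LBINT s=0..u. q s)) \<and>
     (\<forall>v \<in> {-b..b}. H 0 v = h / 2)"

definition transmutation_kernel ::
  "real \<Rightarrow> (real \<Rightarrow> complex) \<Rightarrow> complex \<Rightarrow> (real \<Rightarrow> real \<Rightarrow> complex) \<Rightarrow> bool" where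
  "transmutation_kernel b q h K \<longleftrightarrow>
     (\<exists>H. goursat_solution b q h H \<and>
        (\<forall>x \<in> {-b..b}. \<forall>t \<in> {-b..b}. K x t = H ((x + t) / 2) ((x - t) / 2)))"

end

theory Submission imports Defs begin

text \<open>
  The diagonal \<open>t = -x\<close> is the axis \<open>u = 0\<close> in the characteristic variables, where
  \<open>H 0 v = h / 2\<close> is constant, so the derivative along it vanishes. Across it,
  \<open>\<partial>H/\<partial>u (0, v)\<close> starts from \<open>q 0 / 2\<close> at \<open>v = 0\<close> and grows at the rate
  \<open>q v * H 0 v = q v * h / 2\<close>, so that \<open>\<partial>H/\<partial>u (0, x) = q 0 / 2 + h / 2 * Q x\<close>. Since \<open>u\<close>
  changes at half the speed of either \<open>x\<close> or \<open>t\<close>, both partial derivatives of the kernel are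
  half of this value.

  To make this rigorous without first proving that \<open>H\<close> is continuously differentiable, compare
  \<open>H u v - H u 0\<close> with its linear part \<open>u * h / 2 * Q v\<close>. The mixed derivative of the
  difference is \<open>q (u + v) * H u v - q v * H 0 v\<close>, which is uniformly small near the axis
  because \<open>q (u + v) * H u v\<close> is uniformly continuous on the compact diamond. Two applications
  of the mean value inequality, in \<open>u\<close> and then in \<open>v\<close>, bound the difference by
  \<open>e * \<bar>u\<bar> * \<bar>v\<bar>\<close> inside the diamond (\<open>goursat_remainder_bound_interior\<close>). An
  estimate of this kind survives the passage to the boundary (\<open>goursat_remainder_bound\<close>), which
  is needed because the corners \<open>(0, \<plusminus>b)\<close> are approached along edges of the diamond. It yields
  total differentiability of \<open>H\<close> at every point of the axis, relative to the closed diamond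
  (\<open>goursat_solution_has_derivative_on_axis\<close>), and the chain rule does the rest.
\<close>

lemma mem_goursat_domain_iff: "(u, v) \<in> goursat_domain b \<longleftrightarrow> \<bar>u\<bar> + \<bar>v\<bar> \<le> b"
  unfolding goursat_domain_def by auto

lemma interior_goursat_domainI:
  assumes "\<bar>u\<bar> + \<bar>v\<bar> < b"
  shows "(u, v) \<in> interior (goursat_domain b)"
proof -
  let ?S = "{p :: real \<times> real. \<bar>fst p\<bar> + \<bar>snd p\<bar> < b}"
  have "open ?S"
    by (intro open_Collect_less continuous_intros)
  moreover have "?S \<subseteq> goursat_domain b"
    by (auto simp: mem_goursat_domain_iff)
  ultimately have "?S \<subseteq> interior (goursat_domain b)"
    by (rule interior_maximal[rotated])
  with assms show ?thesis by auto
qed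

lemma compact_goursat_domain: "compact (goursat_domain b)"
proof (rule compact_eq_bounded_closed[THEN iffD2], intro conjI)
  have "goursat_domain b \<subseteq> cbox (-b, -b) (b, b)"
    by (auto simp: mem_goursat_domain_iff cbox_Pair_eq)
  then show "bounded (goursat_domain b)"
    using bounded_cbox bounded_subset by blast
  have "goursat_domain b = {p. \<bar>fst p\<bar> + \<bar>snd p\<bar> \<le> b}"
    by (auto simp: mem_goursat_domain_iff)
  also have "closed \<dots>"
    by (intro closed_Collect_le continuous_intros)
  finally show "closed (goursat_domain b)" .
qed

text \<open>
  The base point is \<open>0\<close> because every segment used below starts on a coordinate axis, where the
  Goursat data are prescribed.
\<close>

lemma norm_diff_le_of_vector_derivative_bound:
  fixes f f' :: "real \<Rightarrow> 'a::real_normed_vector"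
  assumes "\<And>t. t \<in> closed_segment 0 u \<Longrightarrow> (f has_vector_derivative f' t) (at t)"
    and "\<And>t. t \<in> closed_segment 0 u \<Longrightarrow> norm (f' t) \<le> B"
  shows "norm (f u - f 0) \<le> B * \<bar>u\<bar>"
proof -
  have "norm (f u - f 0) \<le> B * norm (u - 0)"
  proof (rule differentiable_bound[of "closed_segment 0 u"])
    fix t assume t: "t \<in> closed_segment 0 u"
    show "(f has_derivative (\<lambda>s. s *\<^sub>R f' t)) (at t within closed_segment 0 u)"
      using assms(1)[OF t] unfolding has_vector_derivative_def by (rule has_derivative_at_withinI)
    show "onorm (\<lambda>s. s *\<^sub>R f' t) \<le> B"
      using assms(2)[OF t] by (simp add: onorm_scaleR_left onorm_id)
  qed auto
  then show ?thesis by simp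
qed

lemma abs_le_of_mem_segment: "t \<in> closed_segment 0 u \<Longrightarrow> \<bar>t\<bar> \<le> \<bar>u\<bar>" for t u :: real
  by (auto simp: closed_segment_eq_real_ivl split: if_splits)

lemma integral_from_0_has_vector_derivative:
  fixes q :: "real \<Rightarrow> complex"
  assumes "b > 0" "continuous_on {-b..b} q" "x \<in> {-b..b}"
  shows "((\<lambda>y. LBINT s=0..y. q s) has_vector_derivative q x) (at x within {-b..b})"
proof -
  have "((\<lambda>y. LBINT s=ereal 0..y. q s) has_vector_derivative q x) (at x within {-b..b})"
    by (rule interval_integral_FTC2) (use assms in auto)
  then show ?thesis by (simp add: zero_ereal_def)
qed

text \<open>
  Both mean value steps need the derivatives from the equation along a whole axis-parallel path
  from \<open>(u, 0)\<close> to \<open>(u, v)\<close> and from \<open>(0, \<beta>)\<close> to \<open>(u, \<beta>)\<close>; these paths stay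
  in the interior since a point moved towards an axis remains in the diamond.
\<close>

lemma goursat_remainder_bound_interior:
  assumes b: "b > 0" and q: "continuous_on {-b..b} q" and H: "goursat_solution b q h H"
    and close: "\<And>\<alpha> \<beta>. (\<alpha>, \<beta>) \<in> goursat_domain b \<Longrightarrow> \<bar>\<alpha>\<bar> < d \<Longrightarrow>
      norm (q (\<alpha> + \<beta>) * H \<alpha> \<beta> - q \<beta> * (h / 2)) \<le> e"
    and uv: "\<bar>u\<bar> + \<bar>v\<bar> < b" "\<bar>u\<bar> < d"
  shows "norm (H u v - H u 0 - u *\<^sub>R (h / 2 * (LBINT s=0..v. q s))) \<le> e * \<bar>u\<bar> * \<bar>v\<bar>"
proof -
  obtain Hv where Hv: "\<And>u v. \<bar>u\<bar> + \<bar>v\<bar> < b \<Longrightarrow> (H u has_vector_derivative Hv u v) (at v)"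
    and Hvu: "\<And>u v. \<bar>u\<bar> + \<bar>v\<bar> < b \<Longrightarrow>
      ((\<lambda>u'. Hv u' v) has_vector_derivative q (u + v) * H u v) (at u)"
    using H interior_goursat_domainI unfolding goursat_solution_def by fast
  have Hv_0: "Hv 0 \<beta> = 0" if "\<bar>\<beta>\<bar> < b" for \<beta>
  proof -
    have "((\<lambda>_. h / 2) has_vector_derivative Hv 0 \<beta>) (at \<beta>)"
    proof (rule has_vector_derivative_transform_within_open[OF Hv])
      show "open {-b<..<b}" by simp
      show "H 0 v = h / 2" if "v \<in> {-b<..<b}" for v
        using H that unfolding goursat_solution_def by auto
    qed (use that in auto)
    then show ?thesis
      by (rule vector_derivative_unique_at) (rule has_vector_derivative_const)
  qed
  have Hv_bound: "norm (Hv u \<beta> - u *\<^sub>R (q \<beta> * (h / 2))) \<le> e * \<bar>u\<bar>" if "\<bar>\<beta>\<bar> \<le> \<bar>v\<bar>" for \<beta>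
  proof -
    let ?f = "\<lambda>\<alpha>. Hv \<alpha> \<beta> - \<alpha> *\<^sub>R (q \<beta> * (h / 2))"
    have "norm (?f u - ?f 0) \<le> e * \<bar>u\<bar>"
    proof (rule norm_diff_le_of_vector_derivative_bound)
      fix \<alpha> assume "\<alpha> \<in> closed_segment 0 u"
      then have \<alpha>: "\<bar>\<alpha>\<bar> \<le> \<bar>u\<bar>" by (rule abs_le_of_mem_segment)
      show "(?f has_vector_derivative q (\<alpha> + \<beta>) * H \<alpha> \<beta> - q \<beta> * (h / 2)) (at \<alpha>)"
        using Hvu[of \<alpha> \<beta>] \<alpha> that uv by (auto intro!: derivative_eq_intros)
      show "norm (q (\<alpha> + \<beta>) * H \<alpha> \<beta> - q \<beta> * (h / 2)) \<le> e"
        using \<alpha> that uv by (intro close) (auto simp: mem_goursat_domain_iff)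
    qed
    then show ?thesis using Hv_0[of \<beta>] that uv by simp
  qed
  let ?g = "\<lambda>\<beta>. H u \<beta> - u *\<^sub>R (h / 2 * (LBINT s=0..\<beta>. q s))"
  have "norm (?g v - ?g 0) \<le> (e * \<bar>u\<bar>) * \<bar>v\<bar>"
  proof (rule norm_diff_le_of_vector_derivative_bound)
    fix \<beta> assume "\<beta> \<in> closed_segment 0 v"
    then have \<beta>: "\<bar>\<beta>\<bar> \<le> \<bar>v\<bar>" by (rule abs_le_of_mem_segment)
    then have mem: "\<beta> \<in> {-b<..<b}" using uv by auto
    have "((\<lambda>y. LBINT s=0..y. q s) has_vector_derivative q \<beta>) (at \<beta> within {-b<..<b})"
      by (rule has_vector_derivative_within_subset[OF integral_from_0_has_vector_derivative[OF b q]])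
        (use mem in auto)
    then have "((\<lambda>y. LBINT s=0..y. q s) has_vector_derivative q \<beta>) (at \<beta>)"
      by (simp only: at_within_open[OF mem open_greaterThanLessThan])
    then have "((\<lambda>y. u *\<^sub>R (h / 2 * (LBINT s=0..y. q s))) has_vector_derivative
        u *\<^sub>R (h / 2 * q \<beta>)) (at \<beta>)"
      by (intro bounded_linear.has_vector_derivative[OF bounded_linear_scaleR_right]
          has_vector_derivative_mult_right)
    moreover have "(H u has_vector_derivative Hv u \<beta>) (at \<beta>)"
      using \<beta> uv by (intro Hv) auto
    ultimately have "(?g has_vector_derivative Hv u \<beta> - u *\<^sub>R (h / 2 * q \<beta>)) (at \<beta>)"
      by (rule has_vector_derivative_diff[rotated])
    then show "(?g has_vector_derivative Hv u \<beta> - u *\<^sub>R (q \<beta> * (h / 2))) (at \<beta>)"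
      by (simp only: mult.commute)
    show "norm (Hv u \<beta> - u *\<^sub>R (q \<beta> * (h / 2))) \<le> e * \<bar>u\<bar>"
      using \<beta> by (rule Hv_bound)
  qed
  moreover have "(LBINT s=0..ereal 0. q s) = 0"
    by (simp flip: zero_ereal_def)
  ultimately show ?thesis by (simp add: algebra_simps)
qed

text \<open>
  Uniform continuity supplies a width \<open>d\<close> that serves the whole strip around the axis. The
  boundary is reached by scaling: the diamond is star-shaped, so \<open>(s * u, s * v)\<close> lies in the
  interior for \<open>s < 1\<close>, and the inequality is preserved as \<open>s\<close> tends to \<open>1\<close>.
\<close>

lemma goursat_remainder_bound:
  assumes b: "b > 0" and q: "continuous_on {-b..b} q" and H: "goursat_solution b q h H"
    and e: "e > 0"
  obtains d where "d > 0"
    and "\<And>u v. (u, v) \<in> goursat_domain b \<Longrightarrow> \<bar>u\<bar> < d \<Longrightarrow>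
      norm (H u v - H u 0 - u *\<^sub>R (h / 2 * (LBINT s=0..v. q s))) \<le> e * \<bar>u\<bar> * \<bar>v\<bar>"
proof -
  let ?D = "goursat_domain b"
  have contH: "continuous_on ?D (\<lambda>p. H (fst p) (snd p))"
    using H unfolding goursat_solution_def by (simp add: case_prod_beta)
  have "continuous_on ?D (\<lambda>p. q (fst p + snd p) * H (fst p) (snd p))"
    by (intro continuous_intros contH continuous_on_compose2[OF q])
      (auto simp: goursat_domain_def)
  then have "uniformly_continuous_on ?D (\<lambda>p. q (fst p + snd p) * H (fst p) (snd p))"
    using compact_goursat_domain compact_uniformly_continuous by blast
  then obtain d where d: "d > 0" and unif: "\<And>p p'. p \<in> ?D \<Longrightarrow> p' \<in> ?D \<Longrightarrow> dist p' p < d \<Longrightarrow>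
      dist (q (fst p' + snd p') * H (fst p') (snd p')) (q (fst p + snd p) * H (fst p) (snd p)) < e"
    unfolding uniformly_continuous_on_def using e by metis
  have close: "norm (q (\<alpha> + \<beta>) * H \<alpha> \<beta> - q \<beta> * (h / 2)) \<le> e"
    if "(\<alpha>, \<beta>) \<in> ?D" "\<bar>\<alpha>\<bar> < d" for \<alpha> \<beta>
  proof -
    have "\<beta> \<in> {-b..b}"
      using that by (auto simp: mem_goursat_domain_iff)
    then have "H 0 \<beta> = h / 2"
      using H unfolding goursat_solution_def by blast
    moreover have "(0, \<beta>) \<in> ?D"
      using that by (auto simp: mem_goursat_domain_iff)
    ultimately show ?thesis
      using unif[of "(0, \<beta>)" "(\<alpha>, \<beta>)"] that
      by (simp add: dist_Pair_Pair dist_norm del: times_divide_eq_right eq_divide_eq_numeral1)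
  qed
  have "norm (H u v - H u 0 - u *\<^sub>R (h / 2 * (LBINT s=0..v. q s))) \<le> e * \<bar>u\<bar> * \<bar>v\<bar>"
    if uv: "(u, v) \<in> ?D" "\<bar>u\<bar> < d" for u v
  proof -
    let ?Q = "\<lambda>y. LBINT s=0..y. q s"
    let ?r = "\<lambda>u v. norm (H u v - H u 0 - u *\<^sub>R (h / 2 * ?Q v)) - e * \<bar>u\<bar> * \<bar>v\<bar>"
    have scale: "\<bar>s * u\<bar> + \<bar>s * v\<bar> \<le> s * b" "\<bar>s * u\<bar> \<le> \<bar>u\<bar>" if "s \<in> {0..1}" for s
    proof -
      have "s * (\<bar>u\<bar> + \<bar>v\<bar>) \<le> s * b"
        using that uv by (intro mult_left_mono) (auto simp: mem_goursat_domain_iff)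
      then show "\<bar>s * u\<bar> + \<bar>s * v\<bar> \<le> s * b" "\<bar>s * u\<bar> \<le> \<bar>u\<bar>"
        using that by (auto simp: abs_mult algebra_simps mult_left_le_one_le)
    qed
    have "s * b \<le> b" if "s \<in> {0..1}" for s
      using that b by (simp add: mult_left_le_one_le)
    with scale(1) have mem: "\<bar>s * u\<bar> + \<bar>s * v\<bar> \<le> b" if "s \<in> {0..1}" for s
      using that by (meson order_trans)
    have contQ: "continuous_on {-b..b} ?Q"
      using integral_from_0_has_vector_derivative[OF b q] has_vector_derivative_continuous
      unfolding continuous_on_eq_continuous_within by blast
    have "continuous_on {0..1} (\<lambda>s. ?r (s * u) (s * v))"
    proof (intro continuous_intros)
      show "continuous_on {0..1} (\<lambda>s. H (s * u) (s * v))"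
        by (rule continuous_on_compose2[OF contH, where f = "\<lambda>s. (s * u, s * v)", simplified])
          (use mem in \<open>auto intro!: continuous_intros simp: mem_goursat_domain_iff\<close>)
      show "continuous_on {0..1} (\<lambda>s. H (s * u) 0)"
        by (rule continuous_on_compose2[OF contH, where f = "\<lambda>s. (s * u, 0)", simplified])
          (use mem in \<open>fastforce intro!: continuous_intros simp: mem_goursat_domain_iff\<close>)+
      show "continuous_on {0..1} (\<lambda>s. ?Q (s * v))"
        by (rule continuous_on_compose2[OF contQ])
          (use mem in \<open>fastforce intro!: continuous_intros\<close>)+
    qed
    moreover have "?r (s * u) (s * v) \<le> 0" if s: "s \<in> {0..<1}" for s
    proof -
      have "s * b < b" using s b by simp
      then have "\<bar>s * u\<bar> + \<bar>s * v\<bar> < b" "\<bar>s * u\<bar> < d"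
        using scale[of s] s uv by auto
      then show ?thesis
        using goursat_remainder_bound_interior[OF b q H close] by simp
    qed
    ultimately have "?r (1 * u) (1 * v) \<le> 0"
      using continuous_le_on_closure[of "{0..<1}" "\<lambda>s. ?r (s * u) (s * v)" 1 0] by simp
    then show ?thesis by simp
  qed
  with d that show ?thesis by blast
qed

text \<open>
  Near \<open>(0, x)\<close> the function splits into the datum \<open>H u 0\<close>, whose derivative at \<open>0\<close> is
  \<open>q 0 / 2\<close>, the linear term \<open>u * h / 2 * Q x\<close>, and a remainder of order \<open>o(u)\<close>.
  Total differentiability is what the chain rule requires, since \<open>v\<close> varies together with
  \<open>u\<close> when one variable of the kernel is held fixed.
\<close>

lemma goursat_solution_has_derivative_on_axis:
  assumes b: "b > 0" and q: "continuous_on {-b..b} q" and H: "goursat_solution b q h H"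
    and x: "x \<in> {-b..b}"
  shows "((\<lambda>p. H (fst p) (snd p)) has_derivative
      (\<lambda>p. fst p *\<^sub>R (q 0 / 2 + h / 2 * (LBINT s=0..x. q s))))
    (at (0, x) within goursat_domain b)"
proof -
  let ?D = "goursat_domain b"
  let ?Q = "\<lambda>y. LBINT s=0..y. q s"
  let ?r = "\<lambda>p. H (fst p) (snd p) - H (fst p) 0 - fst p *\<^sub>R (h / 2 * ?Q x)"
  have H_0: "H 0 v = h / 2" if "v \<in> {-b..b}" for v
    using H that unfolding goursat_solution_def by blast
  have Hu: "((\<lambda>u. H u 0) has_vector_derivative q 0 / 2) (at 0 within {-b..b})"
  proof (rule has_vector_derivative_transform)
    show "((\<lambda>u. h / 2 + 1 / 2 * ?Q u) has_vector_derivative q 0 / 2) (at 0 within {-b..b})"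
      by (rule derivative_eq_intros integral_from_0_has_vector_derivative[OF b q] refl
          | use b in simp)+
  qed (use b H in \<open>auto simp: goursat_solution_def\<close>)
  have base: "((\<lambda>p. H (fst p) 0) has_derivative (\<lambda>p. fst p *\<^sub>R (q 0 / 2))) (at (0, x) within ?D)"
  proof (rule has_derivative_in_compose[OF has_derivative_fst[OF has_derivative_ident]])
    have "fst ` ?D \<subseteq> {-b..b}"
      by (auto simp: mem_goursat_domain_iff)
    then show "((\<lambda>u. H u 0) has_derivative (\<lambda>t. t *\<^sub>R (q 0 / 2))) (at (fst (0, x)) within fst ` ?D)"
      using Hu unfolding has_vector_derivative_def by (auto intro: has_derivative_subset)
  qed
  have rem: "(?r has_derivative (\<lambda>_. 0)) (at (0, x) within ?D)"
    unfolding has_derivative_within_alt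
  proof (intro conjI allI impI)
    fix e :: real assume e: "e > 0"
    \<comment> \<open>The remainder is at most \<open>\<epsilon> * \<bar>u\<bar> * \<bar>v\<bar>\<close> with \<open>\<bar>v\<bar> \<le> b\<close>, plus the error
      \<open>\<bar>u\<bar> * norm (h / 2) * \<epsilon>\<close> of replacing \<open>Q v\<close> by \<open>Q x\<close>.\<close>
    define \<epsilon> where "\<epsilon> = e / (b + norm (h / 2))"
    have pos: "b + norm (h / 2) > 0" using b by (simp add: add_pos_nonneg)
    have \<epsilon>: "\<epsilon> > 0" "\<epsilon> * (b + norm (h / 2)) \<le> e"
      using divide_pos_pos[OF e pos] pos unfolding \<epsilon>_def by auto
    obtain d1 where d1: "d1 > 0" "\<And>u v. (u, v) \<in> ?D \<Longrightarrow> \<bar>u\<bar> < d1 \<Longrightarrow>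
        norm (H u v - H u 0 - u *\<^sub>R (h / 2 * ?Q v)) \<le> \<epsilon> * \<bar>u\<bar> * \<bar>v\<bar>"
      using goursat_remainder_bound[OF b q H \<epsilon>(1)] by metis
    have "continuous (at x within {-b..b}) ?Q"
      using integral_from_0_has_vector_derivative[OF b q x] has_vector_derivative_continuous by blast
    then obtain d2 where d2: "d2 > 0"
      "\<And>v. v \<in> {-b..b} \<Longrightarrow> dist v x < d2 \<Longrightarrow> dist (?Q v) (?Q x) < \<epsilon>"
      using \<epsilon>(1) unfolding continuous_within_eps_delta by metis
    have "norm (?r p - ?r (0, x) - 0) \<le> e * norm (p - (0, x))"
      if p: "p \<in> ?D" "norm (p - (0, x)) < min d1 d2" for p
    proof -
      obtain u v where [simp]: "p = (u, v)" by (cases p)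
      have v: "\<bar>v\<bar> \<le> b" using p by (simp add: mem_goursat_domain_iff)
      have u_le: "\<bar>u\<bar> \<le> norm (p - (0, x))" and v_le: "\<bar>v - x\<bar> \<le> norm (p - (0, x))"
        using norm_fst_le[of u "v - x"] norm_snd_le[of "v - x" u] by auto
      have "?r p = (H u v - H u 0 - u *\<^sub>R (h / 2 * ?Q v)) + u *\<^sub>R (h / 2 * (?Q v - ?Q x))"
        by (simp add: algebra_simps)
      also have "norm \<dots> \<le> \<epsilon> * \<bar>u\<bar> * \<bar>v\<bar> + \<bar>u\<bar> * (norm (h / 2) * \<epsilon>)"
      proof (rule norm_triangle_mono)
        show "norm (H u v - H u 0 - u *\<^sub>R (h / 2 * ?Q v)) \<le> \<epsilon> * \<bar>u\<bar> * \<bar>v\<bar>"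
          using p u_le by (intro d1) auto
        have "v \<in> {-b..b}" "dist v x < d2"
          using v v_le p(2) by (auto simp: dist_norm)
        from d2(2)[OF this] have "norm (?Q v - ?Q x) \<le> \<epsilon>"
          by (simp add: dist_norm)
        then show "norm (u *\<^sub>R (h / 2 * (?Q v - ?Q x))) \<le> \<bar>u\<bar> * (norm (h / 2) * \<epsilon>)"
          unfolding norm_scaleR norm_mult by (intro mult_left_mono) auto
      qed
      also have "\<dots> \<le> \<bar>u\<bar> * (\<epsilon> * (b + norm (h / 2)))"
        using mult_left_mono[OF v, of "\<epsilon> * \<bar>u\<bar>"] \<epsilon>(1) by (simp add: algebra_simps)
      also have "\<dots> \<le> \<bar>u\<bar> * e"
        using \<epsilon>(2) by (intro mult_left_mono) auto
      also have "\<dots> \<le> e * norm (p - (0, x))"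
        using u_le e by (simp add: mult.commute)
      finally have "norm (?r p) \<le> e * norm (p - (0, x))" .
      moreover have "H 0 x = H 0 0" by (rule trans[OF H_0 H_0[symmetric]]) (use x b in auto)
      ultimately show ?thesis by simp
    qed
    then show "\<exists>d>0. \<forall>p\<in>?D. norm (p - (0, x)) < d \<longrightarrow>
        norm (?r p - ?r (0, x) - 0) \<le> e * norm (p - (0, x))"
      using d1(1) d2(1) by (intro exI[of _ "min d1 d2"]) auto
  qed simp
  have "((\<lambda>p. ?r p + H (fst p) 0 + fst p *\<^sub>R (h / 2 * ?Q x)) has_derivative
      (\<lambda>p. 0 + fst p *\<^sub>R (q 0 / 2) + fst p *\<^sub>R (h / 2 * ?Q x))) (at (0, x) within ?D)"
    by (intro has_derivative_add rem base has_derivative_scaleR_left has_derivative_fst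
        has_derivative_ident)
  then show ?thesis by (simp add: algebra_simps)
qed

theorem proposition2p8:
  fixes b :: real and q :: "real \<Rightarrow> complex" and h :: complex
    and K :: "real \<Rightarrow> real \<Rightarrow> complex" and Q :: "real \<Rightarrow> complex"
  assumes "b > 0"
    and "continuous_on {-b..b} q"
    and "transmutation_kernel b q h K"
    and "\<And>x. x \<in> {-b..b} \<Longrightarrow> Q x = (LBINT s=0..x. q s)"
  shows "\<forall>x \<in> {-b..b}.
    ((\<lambda>y. K y (-x)) has_vector_derivative (q 0 / 4 + h / 4 * Q x)) (at x within {-b..b}) \<and>
    ((\<lambda>t. K x t) has_vector_derivative (q 0 / 4 + h / 4 * Q x)) (at (-x) within {-b..b})"
proof
  fix x assume x: "x \<in> {-b..b}"
  obtain H where H: "goursat_solution b q h H"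
    and K: "\<And>x t. x \<in> {-b..b} \<Longrightarrow> t \<in> {-b..b} \<Longrightarrow> K x t = H ((x + t) / 2) ((x - t) / 2)"
    using assms(3) unfolding transmutation_kernel_def by blast
  let ?c = "q 0 / 2 + h / 2 * Q x"
  have dH: "((\<lambda>p. H (fst p) (snd p)) has_derivative (\<lambda>p. fst p *\<^sub>R ?c))
      (at (0, x) within goursat_domain b)"
    using goursat_solution_has_derivative_on_axis[OF assms(1,2) H x] assms(4)[OF x] by simp
  have chain: "((\<lambda>s. H (f s) (g s)) has_vector_derivative (q 0 / 4 + h / 4 * Q x))
      (at a within {-b..b})"
    if f: "(f has_real_derivative 1 / 2) (at a within {-b..b})"
      and g: "(g has_real_derivative g') (at a within {-b..b})"
      and at: "f a = 0" "g a = x"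
      and dom: "\<And>s. s \<in> {-b..b} \<Longrightarrow> (f s, g s) \<in> goursat_domain b" for f g a g'
  proof -
    have dfg: "((\<lambda>s. (f s, g s)) has_derivative (\<lambda>t. (1 / 2 * t, g' * t))) (at a within {-b..b})"
      using f g unfolding has_field_derivative_def by (rule has_derivative_Pair)
    have "((\<lambda>p. H (fst p) (snd p)) has_derivative (\<lambda>p. fst p *\<^sub>R ?c))
        (at (f a, g a) within (\<lambda>s. (f s, g s)) ` {-b..b})"
      unfolding at by (rule has_derivative_subset[OF dH]) (use dom in auto)
    from has_derivative_in_compose[OF dfg this]
    have "((\<lambda>s. H (f s) (g s)) has_derivative (\<lambda>t. (1 / 2 * t) *\<^sub>R ?c)) (at a within {-b..b})"
      by simp
    moreover have "(\<lambda>t. (1 / 2 * t) *\<^sub>R ?c) = (\<lambda>t. t *\<^sub>R (q 0 / 4 + h / 4 * Q x))"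
      by (rule ext) (simp add: scaleR_conv_of_real field_simps)
    ultimately show ?thesis by (simp add: has_vector_derivative_def)
  qed
  show "((\<lambda>y. K y (-x)) has_vector_derivative (q 0 / 4 + h / 4 * Q x)) (at x within {-b..b}) \<and>
    ((\<lambda>t. K x t) has_vector_derivative (q 0 / 4 + h / 4 * Q x)) (at (-x) within {-b..b})"
  proof
    have "((\<lambda>y. H ((y + (-x)) / 2) ((y - (-x)) / 2)) has_vector_derivative
        (q 0 / 4 + h / 4 * Q x)) (at x within {-b..b})"
      using x by (intro chain[where g' = "1 / 2"])
        (auto intro!: derivative_eq_intros simp: goursat_domain_def field_simps)
    then show "((\<lambda>y. K y (-x)) has_vector_derivative (q 0 / 4 + h / 4 * Q x)) (at x within {-b..b})"
      by (rule has_vector_derivative_transform[rotated 2]) (use x K in auto)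
    have "((\<lambda>t. H ((x + t) / 2) ((x - t) / 2)) has_vector_derivative
        (q 0 / 4 + h / 4 * Q x)) (at (-x) within {-b..b})"
      using x by (intro chain[where g' = "- 1 / 2"])
        (auto intro!: derivative_eq_intros simp: goursat_domain_def field_simps)
    then show "((\<lambda>t. K x t) has_vector_derivative (q 0 / 4 + h / 4 * Q x)) (at (-x) within {-b..b})"
      by (rule has_vector_derivative_transform[rotated 2]) (use x K in auto)
  qed
qed

end
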